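(* Let $H$ be a complex Hilbert space, let $\mathcal{E}$ be a totally ordered complete family of partial isometries in $B(H)$, and let $$\mathcal{A}_{\mathcal{E}}=\{T\in B(H)\colon (I-Q_E)TP_E=0\text{ for all }E\in\mathcal{E}\}$$ be a $2$-nest algebra, i.e. suppose that $\mathcal{A}_{\mathcal{E}}$ is a subalgebra of $B(H)$. If $R$ is an operator of rank $n\in\mathbb{N}$ in $\mathcal{A}_{\mathcal{E}}$, then $R$ can be written as the sum of $n$ rank one operators in $\mathcal{A}_{\mathcal{E}}$.
   Context: $B(H)$ is the set of bounded linear operators on $H$ and $I$ is the identity operator. A partial isometry is $V\in B(H)$ with $\|Vx\|=\|x\|$ for all $x\in\ker(V)^\perp$; its initial space is $\ker(V)^\perp$ and its final space is $\operatorname{ran}(V)$. $P_V=V^*V$ and $Q_V=VV^*$ are the orthogonal projections onto the initial and final spaces. Partial isometries are ordered by the Halmos--McLaughlin ordering: $E\le F$ if $F(x)=E(x)$ for all $x$ in the initial space of $E$ (so that the initial space of $E$ is contained in that of $F$). A family of partial isometries is complete if it contains $0$ and, for every nonempty subset of it, the supremum and infimum (in the poset of all partial isometries on $H$) exist and lie in the family. $\mathbb{N}$ denotes the positive integers. *)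

theory Defs
  imports "HOL-Analysis.Analysis"
begin

text \<open>
  Complex inner product spaces, built on the library's real normed spaces.  The scalar
  multiplication extends the real one, and the inner product is linear in its first argument.
  The last axiom says that \<open>cinner x x\<close> is real and equal to the square of the norm; together
  with the norm axioms this gives positive definiteness.
\<close>

class complex_inner = real_normed_vector +
  fixes scaleC :: "complex \<Rightarrow> 'a \<Rightarrow> 'a"  (infixr \<open>*\<^sub>C\<close> 75)
    and cinner :: "'a \<Rightarrow> 'a \<Rightarrow> complex"
  assumes scaleC_add_right: "a *\<^sub>C (x + y) = a *\<^sub>C x + a *\<^sub>C y"
    and scaleC_add_left: "(a + b) *\<^sub>C x = a *\<^sub>C x + b *\<^sub>C x"
    and scaleC_scaleC: "a *\<^sub>C (b *\<^sub>C x) = (a * b) *\<^sub>C x"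
    and scaleC_one: "1 *\<^sub>C x = x"
    and scaleR_scaleC: "r *\<^sub>R x = complex_of_real r *\<^sub>C x"
    and cinner_commute: "cinner x y = cnj (cinner y x)"
    and cinner_add_left: "cinner (x + y) z = cinner x z + cinner y z"
    and cinner_scaleC_left: "cinner (a *\<^sub>C x) y = a * cinner x y"
    and cinner_self: "cinner x x = complex_of_real ((norm x)\<^sup>2)"

class chilbert_space = complex_inner + complete_space

instantiation complex :: chilbert_space
begin

definition scaleC_complex :: "complex \<Rightarrow> complex \<Rightarrow> complex" where
  "scaleC_complex a x = a * x"

definition cinner_complex :: "complex \<Rightarrow> complex \<Rightarrow> complex" where
  "cinner_complex x y = x * cnj y"

instance
proof
  fix a b x y z :: complex and r :: real
  show "a *\<^sub>C (x + y) = a *\<^sub>C x + a *\<^sub>C y" "(a + b) *\<^sub>C x = a *\<^sub>C x + b *\<^sub>C x"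
    "a *\<^sub>C (b *\<^sub>C x) = (a * b) *\<^sub>C x" "1 *\<^sub>C x = x"
    by (simp_all add: scaleC_complex_def distrib_left distrib_right mult.assoc)
  show "r *\<^sub>R x = complex_of_real r *\<^sub>C x"
    by (simp add: scaleC_complex_def scaleR_conv_of_real)
  show "cinner x y = cnj (cinner y x)" "cinner (x + y) z = cinner x z + cinner y z"
    "cinner (a *\<^sub>C x) y = a * cinner x y"
    by (simp_all add: scaleC_complex_def cinner_complex_def algebra_simps)
  show "cinner x x = complex_of_real ((norm x)\<^sup>2)"
    unfolding cinner_complex_def by (rule complex_norm_square [symmetric])
qed

end

global_interpretation complex_vector: vector_space "scaleC :: complex \<Rightarrow> 'a \<Rightarrow> 'a::complex_inner"
  defines cdim = complex_vector.dim
  by standard (simp_all add: scaleC_add_right scaleC_add_left scaleC_scaleC scaleC_one)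


definition bounded_clinear :: "('a::complex_inner \<Rightarrow> 'b::complex_inner) \<Rightarrow> bool" where
  "bounded_clinear T \<longleftrightarrow> bounded_linear T \<and> (\<forall>c x. T (c *\<^sub>C x) = c *\<^sub>C T x)"

text \<open>As in the library's real \<open>adjoint\<close>: meaningful for bounded operators on a Hilbert space,
  where the adjoint exists and is unique.\<close>

definition cadjoint :: "('a::complex_inner \<Rightarrow> 'a) \<Rightarrow> 'a \<Rightarrow> 'a" where
  "cadjoint T = (SOME S. \<forall>x y. cinner (T x) y = cinner x (S y))"

text \<open>The complex dimension of the range.  The library's dimension is 0 on infinite-dimensional
  subspaces, so \<open>crank T = n\<close> says that the rank is \<open>n\<close> only for \<open>n > 0\<close>.\<close>

definition crank :: "('a::complex_inner \<Rightarrow> 'a) \<Rightarrow> nat" where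
  "crank T = cdim (range T)"


definition initial_space :: "('a::complex_inner \<Rightarrow> 'a) \<Rightarrow> 'a set" where
  "initial_space V = {x. \<forall>y. V y = 0 \<longrightarrow> cinner x y = 0}"

definition partial_isometry :: "('a::complex_inner \<Rightarrow> 'a) \<Rightarrow> bool" where
  "partial_isometry V \<longleftrightarrow>
    bounded_clinear V \<and> (\<forall>x\<in>initial_space V. norm (V x) = norm x)"

definition initial_proj :: "('a::complex_inner \<Rightarrow> 'a) \<Rightarrow> 'a \<Rightarrow> 'a" where
  "initial_proj V = cadjoint V \<circ> V"

definition final_proj :: "('a::complex_inner \<Rightarrow> 'a) \<Rightarrow> 'a \<Rightarrow> 'a" where
  "final_proj V = V \<circ> cadjoint V"

text \<open>The Halmos--McLaughlin ordering.\<close>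

definition hm_le :: "('a::complex_inner \<Rightarrow> 'a) \<Rightarrow> ('a \<Rightarrow> 'a) \<Rightarrow> bool"  (infix \<open>\<preceq>\<close> 50) where
  "E \<preceq> F \<longleftrightarrow> (\<forall>x\<in>initial_space E. F x = E x)"

definition hm_sup :: "('a::complex_inner \<Rightarrow> 'a) set \<Rightarrow> ('a \<Rightarrow> 'a) \<Rightarrow> bool" where
  "hm_sup S F \<longleftrightarrow> partial_isometry F \<and> (\<forall>E\<in>S. E \<preceq> F) \<and>
    (\<forall>G. partial_isometry G \<and> (\<forall>E\<in>S. E \<preceq> G) \<longrightarrow> F \<preceq> G)"

definition hm_inf :: "('a::complex_inner \<Rightarrow> 'a) set \<Rightarrow> ('a \<Rightarrow> 'a) \<Rightarrow> bool" where
  "hm_inf S F \<longleftrightarrow> partial_isometry F \<and> (\<forall>E\<in>S. F \<preceq> E) \<and>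
    (\<forall>G. partial_isometry G \<and> (\<forall>E\<in>S. G \<preceq> E) \<longrightarrow> G \<preceq> F)"

definition complete_family :: "('a::complex_inner \<Rightarrow> 'a) set \<Rightarrow> bool" where
  "complete_family \<E> \<longleftrightarrow> (\<lambda>x. 0) \<in> \<E> \<and>
    (\<forall>S. S \<subseteq> \<E> \<and> S \<noteq> {} \<longrightarrow> (\<exists>F\<in>\<E>. hm_sup S F) \<and> (\<exists>F\<in>\<E>. hm_inf S F))"

definition op_space :: "('a::complex_inner \<Rightarrow> 'a) set \<Rightarrow> ('a \<Rightarrow> 'a) set" where
  "op_space \<E> = {T. bounded_clinear T \<and>
    (\<forall>E\<in>\<E>. \<forall>x. T (initial_proj E x) - final_proj E (T (initial_proj E x)) = 0)}"

text \<open>Subalgebras are not required to contain the identity.\<close>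

definition subalgebra :: "('a::complex_inner \<Rightarrow> 'a) set \<Rightarrow> bool" where
  "subalgebra \<A> \<longleftrightarrow> \<A> \<subseteq> Collect bounded_clinear \<and> (\<lambda>x. 0) \<in> \<A> \<and>
    (\<forall>S\<in>\<A>. \<forall>T\<in>\<A>. (\<lambda>x. S x + T x) \<in> \<A>) \<and>
    (\<forall>c. \<forall>T\<in>\<A>. (\<lambda>x. c *\<^sub>C T x) \<in> \<A>) \<and>
    (\<forall>S\<in>\<A>. \<forall>T\<in>\<A>. S \<circ> T \<in> \<A>)"

end

theory Submission
  imports Defs
begin

text \<open>
  An operator \<open>T\<close> lies in the algebra exactly when it maps the initial space \<open>M E\<close> of every member
  \<open>E\<close> of the family into its final space \<open>N E\<close> (\<open>op_space_iff\<close>), and the spaces \<open>M E\<close> form a chain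
  because the family is totally ordered (\<open>hm_le_initial_space_mono\<close>).  What remains is linear
  algebra about a chain of subspaces \<open>M E\<close> and arbitrary subspaces \<open>N E\<close>, with an operator \<open>R\<close> of
  finite rank such that \<open>R (M E) \<subseteq> N E\<close> throughout.

  Those images \<open>R (M E)\<close> that are nonzero form a chain of finite-dimensional subspaces, so, unless
  all images are zero, there is a smallest nonzero one.  A nonzero vector \<open>x\<close> in it
  lies in \<open>R (M E)\<close>, hence in \<open>N E\<close>, whenever
  \<open>R (M E) \<noteq> 0\<close> (\<open>vector_in_all_nonzero_images\<close>); if all images are zero, any nonzero \<open>x\<close> in the
  range of \<open>R\<close> will do.  Let \<open>P\<close> be the orthogonal projection onto the line
  of \<open>x\<close>.  The rank one operator \<open>P R\<close> maps each \<open>M E\<close> to zero or into the line of \<open>x\<close>, so it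
  satisfies the same inclusions as \<open>R\<close>, and then so does \<open>R - P R\<close>.  The range of \<open>R - P R\<close> is the
  part of the range of \<open>R\<close> orthogonal to \<open>x\<close>, so its rank is smaller by exactly one
  (\<open>rank_diff_line_proj\<close>), and induction on the rank finishes the argument
  (\<open>rank_one_decomposition\<close>).

  The algebra is defined through \<open>E\<^sup>* E\<close> and \<open>E E\<^sup>*\<close>, so the reduction needs that adjoints exist, which
  rests on the Riesz representation of bounded functionals and thus on the completeness of the
  space.
\<close>

section \<open>Elementary facts on complex inner products\<close>

lemma cinner_add_right: "cinner x (y + z) = cinner x y + cinner x (z :: 'a::complex_inner)"
  by (metis cinner_add_left cinner_commute complex_cnj_add)

lemma cinner_scaleC_right: "cinner x (a *\<^sub>C y) = cnj a * cinner x (y :: 'a::complex_inner)"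
  by (metis cinner_commute cinner_scaleC_left complex_cnj_mult)

lemma cinner_diff_left: "cinner (x - y) z = cinner x z - cinner y (z :: 'a::complex_inner)"
  by (metis add_diff_cancel cinner_add_left diff_add_cancel)

lemma cinner_diff_right: "cinner x (y - z) = cinner x y - cinner x (z :: 'a::complex_inner)"
  by (metis add_diff_cancel cinner_add_right diff_add_cancel)

lemma cinner_zero_left [simp]: "cinner 0 (x :: 'a::complex_inner) = 0"
  by (metis cinner_diff_left diff_self)

lemma cinner_self_eq_0_iff [simp]: "cinner x x = 0 \<longleftrightarrow> (x :: 'a::complex_inner) = 0"
  by (simp add: cinner_self)

lemma norm_add_squared:
  "(norm (x + y))\<^sup>2 = (norm x)\<^sup>2 + (norm y)\<^sup>2 + 2 * Re (cinner x (y :: 'a::complex_inner))"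
proof -
  have "complex_of_real ((norm (x + y))\<^sup>2) = cinner (x + y) (x + y)"
    by (simp add: cinner_self)
  also have "\<dots> = cinner x x + cinner y y + (cinner x y + cnj (cinner x y))"
    using cinner_commute [of y x] by (simp add: cinner_add_left cinner_add_right)
  also have "\<dots> = complex_of_real ((norm x)\<^sup>2 + (norm y)\<^sup>2 + 2 * Re (cinner x y))"
    by (simp add: cinner_self complex_add_cnj)
  finally show ?thesis
    by (simp only: of_real_eq_iff)
qed

lemma norm_scaleC: "norm (a *\<^sub>C x) = norm a * norm (x :: 'a::complex_inner)"
proof -
  have "complex_of_real ((norm (a *\<^sub>C x))\<^sup>2) = (a * cnj a) * cinner x x"
    by (simp only: cinner_self [symmetric] cinner_scaleC_left cinner_scaleC_right mult_ac)
  also have "\<dots> = complex_of_real ((norm a * norm x)\<^sup>2)"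
    by (simp add: cinner_self complex_norm_square [symmetric] power_mult_distrib)
  finally have "(norm (a *\<^sub>C x))\<^sup>2 = (norm a * norm x)\<^sup>2"
    by (simp only: of_real_eq_iff)
  then show ?thesis
    by (simp add: power2_eq_iff_nonneg)
qed

text \<open>
  For \<open>x = 0\<close> the division by zero makes the coefficient, and with it the map, equal to \<open>0\<close>.
\<close>

definition line_proj :: "'a::complex_inner \<Rightarrow> 'a \<Rightarrow> 'a" where
  "line_proj x v = (cinner v x / complex_of_real ((norm x)\<^sup>2)) *\<^sub>C x"

lemma cinner_line_proj: "cinner (line_proj x v) x = cinner v x" if "x \<noteq> 0"
  using that by (simp add: line_proj_def cinner_scaleC_left cinner_self)

lemma line_proj_self: "line_proj x x = x"
  by (cases "x = 0") (simp_all add: line_proj_def cinner_self scaleC_one)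

lemma norm_line_proj_le: "norm (line_proj x v) \<le> norm v"
proof (cases "x = 0")
  case False
  have "cinner (v - line_proj x v) (line_proj x v) = 0"
    using cinner_line_proj [OF False, of v]
    by (simp add: cinner_diff_left line_proj_def cinner_scaleC_right)
  then have "(norm v)\<^sup>2 = (norm (v - line_proj x v))\<^sup>2 + (norm (line_proj x v))\<^sup>2"
    using norm_add_squared [of "v - line_proj x v" "line_proj x v"] by simp
  then have "(norm (line_proj x v))\<^sup>2 \<le> (norm v)\<^sup>2"
    by simp
  then show ?thesis
    by (simp add: power2_le_iff_abs_le)
qed (simp add: line_proj_def)

text \<open>The length of the projection of \<open>x\<close> onto the line of \<open>y\<close> is \<open>|cinner x y| / norm y\<close>.\<close>

lemma cauchy_schwarz: "norm (cinner x y) \<le> norm x * norm (y :: 'a::complex_inner)"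
proof (cases "y = 0")
  case True
  then show ?thesis
    by (metis cinner_commute cinner_zero_left complex_cnj_zero norm_zero mult_zero_right order_refl)
next
  case False
  have "norm (cinner x y) / norm y = norm (line_proj y x)"
    using False by (simp add: line_proj_def norm_scaleC norm_divide norm_power power2_eq_square
        norm_mult)
  then show ?thesis
    using norm_line_proj_le [of y x] False
    by (metis divide_le_eq norm_ge_zero norm_eq_zero order_le_less)
qed

lemma bounded_clinear_line_proj: "bounded_clinear (line_proj x)"
  unfolding bounded_clinear_def
proof (intro conjI allI)
  show "bounded_linear (line_proj x)"
  proof (rule bounded_linear_intro [where K = 1])
    fix v w and r :: real
    show "line_proj x (v + w) = line_proj x v + line_proj x w"
      by (simp add: line_proj_def cinner_add_left add_divide_distrib scaleC_add_left)
    show "line_proj x (r *\<^sub>R v) = r *\<^sub>R line_proj x v"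
      by (simp add: line_proj_def scaleR_scaleC cinner_scaleC_left scaleC_scaleC)
    show "norm (line_proj x v) \<le> norm v * 1"
      by (simp add: norm_line_proj_le)
  qed
  show "line_proj x (c *\<^sub>C v) = c *\<^sub>C line_proj x v" for c v
    by (simp add: line_proj_def cinner_scaleC_left scaleC_scaleC)
qed

lemma bounded_clinear_comp:
  "bounded_clinear S \<Longrightarrow> bounded_clinear T \<Longrightarrow> bounded_clinear (\<lambda>x. S (T x))"
  by (simp add: bounded_clinear_def bounded_linear_compose)

lemma bounded_clinear_diff:
  "bounded_clinear S \<Longrightarrow> bounded_clinear T \<Longrightarrow> bounded_clinear (\<lambda>x. S x - T x)"
  by (simp add: bounded_clinear_def bounded_linear_sub complex_vector.scale_right_diff_distrib)

lemma bounded_clinear_subspace_image: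
  assumes "bounded_clinear T" and "complex_vector.subspace M"
  shows "complex_vector.subspace (T ` M)"
proof (rule complex_vector.subspaceI)
  interpret T: bounded_linear T
    using assms(1) by (simp add: bounded_clinear_def)
  show "0 \<in> T ` M"
    using complex_vector.subspace_0 [OF assms(2)] T.zero by (metis imageI)
  fix x y c assume "x \<in> T ` M" "y \<in> T ` M"
  then obtain u w where uw: "u \<in> M" "w \<in> M" "x = T u" "y = T w"
    by blast
  show "x + y \<in> T ` M"
    using uw complex_vector.subspace_add [OF assms(2)] by (auto simp: T.add [symmetric])
  have "c *\<^sub>C x = T (c *\<^sub>C u)"
    using assms(1) uw by (simp add: bounded_clinear_def)
  then show "c *\<^sub>C x \<in> T ` M"
    using complex_vector.subspace_scale [OF assms(2) uw(1)] by blast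
qed

section \<open>Representation of bounded functionals and existence of adjoints\<close>

text \<open>
  The vector that represents \<open>f\<close> minimises the functional \<open>norm x ^ 2 - 2 Re (f x)\<close>, which equals
  \<open>norm (x - v) ^ 2 - norm v ^ 2\<close> if \<open>v\<close> is that vector.  Minimising sequences are Cauchy by
  the parallelogram law, and the first variation at the minimum gives the representation.
\<close>

lemma riesz_representation:
  fixes f :: "'a::chilbert_space \<Rightarrow> complex"
  assumes "bounded_linear f" and scale: "\<And>c x. f (c *\<^sub>C x) = c * f x"
  shows "\<exists>v. \<forall>x. f x = cinner x v"
proof -
  interpret f: bounded_linear f by fact
  define J where "J x = (norm x)\<^sup>2 - 2 * Re (f x)" for x
  define m where "m = (INF x. J x)"
  obtain K where K: "\<And>x. norm (f x) \<le> norm x * K"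
    using f.bounded by blast
  have J_ge: "- K\<^sup>2 \<le> J x" for x
  proof -
    have "Re (f x) \<le> norm x * K"
      using K [of x] complex_Re_le_cmod [of "f x"] by linarith
    moreover have "0 \<le> (norm x - K)\<^sup>2"
      by simp
    ultimately show ?thesis
      unfolding J_def power2_diff by linarith
  qed
  have bdd: "bdd_below (range J)"
    by (rule bdd_belowI [of _ "- K\<^sup>2"]) (use J_ge in blast)
  have m_le: "m \<le> J x" for x
    unfolding m_def using bdd by (rule cINF_lower) simp
  have "\<exists>x. J x < m + 1 / real (Suc k)" for k
  proof -
    have "m < m + 1 / real (Suc k)" by simp
    then show ?thesis
      unfolding m_def using bdd by (subst (asm) cINF_less_iff) auto
  qed
  then obtain X where X: "\<And>k. J (X k) < m + 1 / real (Suc k)"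
    by metis
  have para: "(norm (x - y))\<^sup>2 \<le> 2 * (J x - m) + 2 * (J y - m)" for x y
  proof -
    have "(norm (x - y))\<^sup>2 = 2 * (norm x)\<^sup>2 + 2 * (norm y)\<^sup>2 - (norm (x + y))\<^sup>2"
      using norm_add_squared [of x y] norm_add_squared [of x "- y"] cinner_diff_right [of x 0 y]
        cinner_diff_right [of x 0 0] by simp
    moreover have "4 * J ((1/2) *\<^sub>R (x + y)) = (norm (x + y))\<^sup>2 - 4 * (Re (f x) + Re (f y))"
      by (simp add: J_def f.scaleR f.add power_divide add_divide_distrib del: scaleR_add_right)
    ultimately show ?thesis
      using m_le [of "(1/2) *\<^sub>R (x + y)"] by (simp add: J_def)
  qed
  have "Cauchy X"
  proof (rule CauchyI)
    fix e :: real assume "0 < e"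
    then obtain k0 where k0: "inverse (real (Suc k0)) < e\<^sup>2 / 4"
      using reals_Archimedean [of "e\<^sup>2 / 4"] by auto
    show "\<exists>M. \<forall>i\<ge>M. \<forall>j\<ge>M. norm (X i - X j) < e"
    proof (intro exI allI impI)
      fix i j assume "k0 \<le> i" "k0 \<le> j"
      have tail: "J (X k) - m < e\<^sup>2 / 4" if "k0 \<le> k" for k
      proof -
        have "1 / real (Suc k) \<le> inverse (real (Suc k0))"
          using that by (simp add: field_simps)
        then show ?thesis using X [of k] k0 by linarith
      qed
      have "(norm (X i - X j))\<^sup>2 < e\<^sup>2"
        using para [of "X i" "X j"] tail [OF \<open>k0 \<le> i\<close>] tail [OF \<open>k0 \<le> j\<close>] by argo
      then show "norm (X i - X j) < e"
        using \<open>0 < e\<close> by (simp add: power_less_imp_less_base)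
    qed
  qed
  then obtain v where v: "X \<longlonglongrightarrow> v"
    using Cauchy_convergent convergent_def by blast
  have "(\<lambda>k. J (X k)) \<longlonglongrightarrow> J v"
    unfolding J_def by (intro tendsto_intros v f.tendsto)
  moreover have "(\<lambda>k. m + 1 / real (Suc k)) \<longlonglongrightarrow> m + 0"
    by (intro tendsto_intros LIMSEQ_Suc [OF lim_1_over_n])
  ultimately have "J v \<le> m"
    using LIMSEQ_le [of "\<lambda>k. J (X k)" "J v" "\<lambda>k. m + 1 / real (Suc k)" "m + 0"]
      less_imp_le [OF X] by auto
  then have min: "J v \<le> J x" for x
    using m_le [of x] by linarith
  have Re_eq: "Re (cinner v h) = Re (f h)" for h
  proof -
    define a where "a = Re (cinner v h) - Re (f h)"
    define s where "s = (norm h)\<^sup>2"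
    have "s \<ge> 0" by (simp add: s_def)
    have quad: "0 \<le> 2 * t * a + t\<^sup>2 * s" for t :: real
    proof -
      have "Re (cinner v (t *\<^sub>R h)) = t * Re (cinner v h)"
        by (simp add: scaleR_scaleC cinner_scaleC_right)
      then have "J (v + t *\<^sub>R h) = J v + 2 * t * a + t\<^sup>2 * s"
        by (simp add: J_def norm_add_squared f.add f.scaleR a_def s_def power_mult_distrib
            algebra_simps)
      then show ?thesis using min [of "v + t *\<^sub>R h"] by linarith
    qed
    \<comment> \<open>A step of this length against the slope \<open>a\<close> lowers the value unless \<open>a = 0\<close>.\<close>
    define t where "t = - a / (s + 1)"
    have a: "a = - t * (s + 1)"
      using \<open>s \<ge> 0\<close> by (simp add: t_def)
    have "2 * t * a + t\<^sup>2 * s = - (t\<^sup>2 * (s + 2))"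
      unfolding a by (simp add: power2_eq_square algebra_simps)
    then have "t\<^sup>2 * (s + 2) \<le> 0"
      using quad [of t] by linarith
    then have "t = 0"
      using \<open>s \<ge> 0\<close> by (simp add: mult_le_0_iff)
    then show ?thesis
      using a by (simp add: a_def)
  qed
  have "f x = cinner x v" for x
  proof (rule complex_eqI)
    show "Re (f x) = Re (cinner x v)"
      using Re_eq [of x] cinner_commute [of x v] by simp
    \<comment> \<open>The imaginary parts are real parts at a rotated argument.\<close>
    show "Im (f x) = Im (cinner x v)"
      using Re_eq [of "\<i> *\<^sub>C x"] cinner_commute [of x v]
      by (simp add: scale cinner_scaleC_right)
  qed
  then show ?thesis by blast
qed

lemma cinner_cadjoint:
  fixes T :: "'a::chilbert_space \<Rightarrow> 'a"
  assumes "bounded_clinear T"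
  shows "cinner (T x) y = cinner x (cadjoint T y)"
proof -
  interpret T: bounded_linear T
    using assms by (simp add: bounded_clinear_def)
  have "\<exists>v. \<forall>x. cinner (T x) y = cinner x v" for y
  proof (rule riesz_representation)
    obtain K where K: "\<And>x. norm (T x) \<le> norm x * K"
      using T.bounded by blast
    show "bounded_linear (\<lambda>x. cinner (T x) y)"
    proof (rule bounded_linear_intro [where K = "K * norm y"])
      fix u w and r :: real
      show "cinner (T (u + w)) y = cinner (T u) y + cinner (T w) y"
        by (simp add: T.add cinner_add_left)
      show "cinner (T (r *\<^sub>R u)) y = r *\<^sub>R cinner (T u) y"
        by (simp add: T.scaleR scaleR_scaleC [of r "T u"] cinner_scaleC_left scaleR_conv_of_real)
      show "norm (cinner (T u) y) \<le> norm u * (K * norm y)"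
        using cauchy_schwarz [of "T u" y] mult_right_mono [OF K [of u], of "norm y"]
        by (simp add: mult.assoc)
    qed
    show "cinner (T (c *\<^sub>C x)) y = c * cinner (T x) y" for c x
      using assms by (simp add: bounded_clinear_def cinner_scaleC_left)
  qed
  then have "\<exists>S. \<forall>x y. cinner (T x) y = cinner x (S y)"
    by metis
  then have "\<forall>x y. cinner (T x) y = cinner x (cadjoint T y)"
    unfolding cadjoint_def by (rule someI_ex)
  then show ?thesis by blast
qed

lemma cinner_left_ext:
  "(\<And>z. cinner z x = cinner z y) \<Longrightarrow> x = (y :: 'a::complex_inner)"
  by (metis cinner_diff_right cinner_self_eq_0_iff eq_iff_diff_eq_0)

lemma
  fixes T :: "'a::chilbert_space \<Rightarrow> 'a"
  assumes "bounded_clinear T"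
  shows cadjoint_add: "cadjoint T (x + y) = cadjoint T x + cadjoint T y"
    and cadjoint_scaleC: "cadjoint T (c *\<^sub>C x) = c *\<^sub>C cadjoint T x"
  by (rule cinner_left_ext,
      simp add: cinner_cadjoint [OF assms, symmetric] cinner_add_right cinner_scaleC_right)+

section \<open>The projections of a partial isometry\<close>

lemma subspace_initial_space:
  "complex_vector.subspace (initial_space V)"
  by (rule complex_vector.subspaceI)
    (auto simp: initial_space_def cinner_add_left cinner_scaleC_left)

lemma cadjoint_in_initial_space:
  fixes V :: "'a::chilbert_space \<Rightarrow> 'a"
  assumes "bounded_clinear V"
  shows "cadjoint V y \<in> initial_space V"
proof -
  have "cinner (cadjoint V y) z = 0" if "V z = 0" for z
  proof -
    have "cinner z (cadjoint V y) = 0"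
      using cinner_cadjoint [OF assms, of z y] that by simp
    then show ?thesis
      by (metis cinner_commute complex_cnj_zero)
  qed
  then show ?thesis
    by (simp add: initial_space_def)
qed

text \<open>Preservation of norms is preservation of inner products, by polarization.\<close>

lemma partial_isometry_cinner:
  assumes V: "partial_isometry V" and x: "x \<in> initial_space V" and y: "y \<in> initial_space V"
  shows "cinner (V x) (V y) = cinner x y"
proof -
  interpret V: bounded_linear V
    using V by (simp add: partial_isometry_def bounded_clinear_def)
  have iso: "norm (V z) = norm z" if "z \<in> initial_space V" for z
    using V that by (simp add: partial_isometry_def)
  have Re_eq: "Re (cinner (V x) (V z)) = Re (cinner x z)" if z: "z \<in> initial_space V" for z
    using norm_add_squared [of "V x" "V z"] norm_add_squared [of x z] iso [OF x] iso [OF z]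
      iso [OF complex_vector.subspace_add [OF subspace_initial_space x z]]
    by (simp add: V.add)
  have "Re (cinner (V x) (V (\<i> *\<^sub>C y))) = Re (cinner x (\<i> *\<^sub>C y))"
    by (intro Re_eq complex_vector.subspace_scale subspace_initial_space y)
  then have "Im (cinner (V x) (V y)) = Im (cinner x y)"
    using V by (simp add: partial_isometry_def bounded_clinear_def cinner_scaleC_right)
  with Re_eq [OF y] show ?thesis
    by (simp add: complex_eqI)
qed

text \<open>
  For \<open>x\<close> in the initial space, \<open>V\<^sup>* V x - x\<close> lies in the initial space and is orthogonal to it.
\<close>

lemma initial_proj_eq:
  fixes V :: "'a::chilbert_space \<Rightarrow> 'a"
  assumes V: "partial_isometry V" and x: "x \<in> initial_space V"
  shows "initial_proj V x = x"
proof -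
  have lin: "bounded_clinear V"
    using V by (simp add: partial_isometry_def)
  define w where "w = initial_proj V x - x"
  have w: "w \<in> initial_space V"
    unfolding w_def initial_proj_def o_def
    by (intro complex_vector.subspace_diff subspace_initial_space x
        cadjoint_in_initial_space lin)
  have "cinner w w = 0"
    using partial_isometry_cinner [OF V w x] cinner_cadjoint [OF lin, of w "V x"]
    by (simp add: w_def initial_proj_def cinner_diff_right)
  then show ?thesis
    by (simp add: w_def)
qed

lemma range_initial_proj:
  fixes V :: "'a::chilbert_space \<Rightarrow> 'a"
  assumes "partial_isometry V"
  shows "range (initial_proj V) = initial_space V"
proof
  show "range (initial_proj V) \<subseteq> initial_space V"
    using assms cadjoint_in_initial_space by (auto simp: partial_isometry_def initial_proj_def)
  show "initial_space V \<subseteq> range (initial_proj V)"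
    using initial_proj_eq [OF assms] by (metis rangeI subsetI)
qed

lemma subspace_fixed_final_proj:
  fixes V :: "'a::chilbert_space \<Rightarrow> 'a"
  assumes "bounded_clinear V"
  shows "complex_vector.subspace {w. final_proj V w = w}"
proof -
  interpret V: bounded_linear V
    using assms by (simp add: bounded_clinear_def)
  have scale: "final_proj V (c *\<^sub>C w) = c *\<^sub>C final_proj V w" for c w
    using assms by (simp add: final_proj_def cadjoint_scaleC [OF assms] bounded_clinear_def)
  show ?thesis
  proof (rule complex_vector.subspaceI)
    show "0 \<in> {w. final_proj V w = w}"
      using scale [of 0 0] by simp
  qed (simp_all add: scale, simp add: final_proj_def cadjoint_add [OF assms] V.add)
qed

text \<open>
  If \<open>E \<preceq> F\<close> then \<open>F\<close> preserves the norm of a vector \<open>x\<close> in the initial space of \<open>E\<close>, which leaves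
  no room for a component of \<open>x\<close> in the kernel of \<open>F\<close>.
\<close>

lemma hm_le_initial_space_mono:
  fixes E F :: "'a::chilbert_space \<Rightarrow> 'a"
  assumes E: "partial_isometry E" and F: "partial_isometry F" and "E \<preceq> F"
  shows "initial_space E \<subseteq> initial_space F"
proof
  fix x assume x: "x \<in> initial_space E"
  have lin: "bounded_clinear F"
    using F by (simp add: partial_isometry_def)
  interpret F: bounded_linear F
    using lin by (simp add: bounded_clinear_def)
  define p where "p = initial_proj F x"
  have p: "p \<in> initial_space F"
    using range_initial_proj [OF F] p_def by blast
  have ker: "F (x - p) = 0"
  proof -
    \<comment> \<open>\<open>F\<^sup>* F\<close> is idempotent, so it annihilates \<open>x - F\<^sup>* F x\<close>.\<close>
    have "cinner (F (x - p)) (F (x - p)) = cinner (x - p) (initial_proj F (x - p))"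
      by (simp add: cinner_cadjoint [OF lin] initial_proj_def)
    also have "initial_proj F (x - p) = 0"
      using initial_proj_eq [OF F p] cadjoint_add [OF lin, of "F (x - p)" "F p"]
      by (simp add: initial_proj_def p_def F.diff)
    finally show ?thesis
      by (metis cinner_commute cinner_self_eq_0_iff cinner_zero_left complex_cnj_zero)
  qed
  then have "cinner p (x - p) = 0"
    using p by (simp add: initial_space_def)
  then have "(norm x)\<^sup>2 = (norm p)\<^sup>2 + (norm (x - p))\<^sup>2"
    using norm_add_squared [of p "x - p"] by simp
  moreover have "norm p = norm x"
  proof -
    have "norm p = norm (F p)"
      using F p by (simp add: partial_isometry_def)
    also have "F p = F x"
      using ker by (simp add: F.diff)
    also have "F x = E x"
      using \<open>E \<preceq> F\<close> x by (simp add: hm_le_def)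
    also have "norm (E x) = norm x"
      using E x by (simp add: partial_isometry_def)
    finally show ?thesis .
  qed
  ultimately have "x = p"
    by simp
  then show "x \<in> initial_space F"
    using p by simp
qed

lemma op_space_iff:
  fixes \<E> :: "('a::chilbert_space \<Rightarrow> 'a) set"
  assumes "\<forall>E\<in>\<E>. partial_isometry E"
  shows "T \<in> op_space \<E> \<longleftrightarrow>
    bounded_clinear T \<and> (\<forall>E\<in>\<E>. T ` initial_space E \<subseteq> {w. final_proj E w = w})"
proof -
  have "(\<forall>x. T (initial_proj E x) - final_proj E (T (initial_proj E x)) = 0) \<longleftrightarrow>
      T ` initial_space E \<subseteq> {w. final_proj E w = w}" if "E \<in> \<E>" for E
    using assms that range_initial_proj [of E, symmetric] by (auto simp: image_subset_iff)
  then show ?thesis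
    by (auto simp: op_space_def)
qed

section \<open>Splitting off rank one operators along a chain of subspaces\<close>

text \<open>
  A member of least dimension works: a member that does not contain it is properly contained in
  it and hence has smaller dimension.
\<close>

lemma smallest_subspace_in_chain:
  fixes \<C> :: "'a::complex_inner set set"
  assumes "\<C> \<noteq> {}" and sub: "\<And>U. U \<in> \<C> \<Longrightarrow> complex_vector.subspace U"
    and chain: "\<And>U W. U \<in> \<C> \<Longrightarrow> W \<in> \<C> \<Longrightarrow> U \<subseteq> W \<or> W \<subseteq> U"
    and fin: "finite B" "\<And>U. U \<in> \<C> \<Longrightarrow> U \<subseteq> complex_vector.span B"
  shows "\<exists>U\<in>\<C>. \<forall>W\<in>\<C>. U \<subseteq> W"
proof -
  obtain U where U: "U \<in> \<C>" and min: "\<And>W. W \<in> \<C> \<Longrightarrow> cdim U \<le> cdim W"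
    using \<open>\<C> \<noteq> {}\<close> ex_has_least_nat [of "\<lambda>U. U \<in> \<C>" _ cdim] by blast
  have "U \<subseteq> W" if W: "W \<in> \<C>" for W
  proof (rule ccontr)
    assume "\<not> U \<subseteq> W"
    then obtain u where u: "u \<in> U" "u \<notin> W"
      by blast
    have "W \<subseteq> U"
      using chain [OF U W] \<open>\<not> U \<subseteq> W\<close> by blast
    obtain b where b: "b \<subseteq> W" "complex_vector.independent b" "W \<subseteq> complex_vector.span b"
      "card b = cdim W"
      by (rule complex_vector.basis_exists [of W])
    have "u \<notin> complex_vector.span b"
      using u complex_vector.span_minimal [OF b(1) sub [OF W]] by blast
    then have ind: "complex_vector.independent (insert u b)"
      using b(2) by (simp add: complex_vector.independent_insertI)
    obtain c where c: "insert u b \<subseteq> c" "c \<subseteq> U" "complex_vector.independent c"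
      "U \<subseteq> complex_vector.span c"
      using complex_vector.maximal_independent_subset_extend [of "insert u b" U] ind u b(1)
        \<open>W \<subseteq> U\<close> by blast
    have "finite c"
      using complex_vector.independent_span_bound [OF fin(1) c(3)] c(2) fin(2) [OF U] by blast
    have "card c = cdim U"
      using complex_vector.basis_card_eq_dim [OF c(2) c(4) c(3)] by simp
    moreover have "card (insert u b) = Suc (card b)"
    proof (rule card_insert_disjoint)
      show "finite b" using \<open>finite c\<close> c(1) by (meson finite_subset insert_subset)
      show "u \<notin> b" using u(2) b(1) by blast
    qed
    moreover have "card (insert u b) \<le> card c"
      using \<open>finite c\<close> c(1) by (rule card_mono)
    ultimately show False
      using min [OF W] b(4) by simp
  qed
  with U show ?thesis by blast
qed

lemma line_proj_range:
  assumes "bounded_clinear R" and "x \<in> range R"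
  shows "range (\<lambda>z. line_proj x (R z)) = complex_vector.span {x}"
proof -
  obtain z0 where z0: "x = R z0"
    using assms(2) by blast
  have "c *\<^sub>C x \<in> range (\<lambda>z. line_proj x (R z))" for c
  proof
    show "c *\<^sub>C x = line_proj x (R (c *\<^sub>C z0))"
      using assms(1) bounded_clinear_line_proj [of x] z0 line_proj_self [of x]
      by (simp add: bounded_clinear_def)
  qed simp
  then show ?thesis
    by (auto simp: complex_vector.span_singleton line_proj_def)
qed

text \<open>
  Projecting the range away from one of its vectors \<open>x\<close> removes exactly the line of \<open>x\<close>: the
  new range is orthogonal to \<open>x\<close>, and adjoining \<open>x\<close> to a basis of it gives a basis of the old one.
\<close>

lemma rank_diff_line_proj:
  assumes R: "bounded_clinear R" and x: "x \<in> range R" "x \<noteq> 0"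
    and B: "finite B" "complex_vector.independent B" "complex_vector.span B = range R"
    and card: "card B = Suc n"
  shows "\<exists>B'. finite B' \<and> complex_vector.independent B' \<and> card B' = n \<and>
    complex_vector.span B' = range (\<lambda>z. R z - line_proj x (R z))"
proof -
  define R' where "R' = (\<lambda>z. R z - line_proj x (R z))"
  have R': "bounded_clinear R'"
    unfolding R'_def
    by (rule bounded_clinear_diff [OF R bounded_clinear_comp [OF bounded_clinear_line_proj R]])
  have sub: "complex_vector.subspace (range R)" "complex_vector.subspace (range R')"
    by (rule bounded_clinear_subspace_image [OF _ complex_vector.subspace_UNIV], fact)+
  have perp: "cinner w x = 0" if "w \<in> range R'" for w
    using that cinner_line_proj [OF x(2)] by (auto simp: R'_def cinner_diff_left)
  obtain B' where B': "B' \<subseteq> range R'" "complex_vector.independent B'"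
    "range R' \<subseteq> complex_vector.span B'"
    by (rule complex_vector.basis_exists [of "range R'"])
  have span': "complex_vector.span B' = range R'"
    using B' sub by (simp add: complex_vector.span_minimal subset_antisym)
  have "line_proj x (R z) \<in> range R" for z
    using complex_vector.subspace_scale [OF sub(1) x(1)] by (simp add: line_proj_def)
  then have "range R' \<subseteq> range R"
    using complex_vector.subspace_diff [OF sub(1)] by (auto simp: R'_def)
  then have "finite B'"
    using complex_vector.independent_span_bound [OF B(1) B'(2)] B'(1) B(3) by blast
  have "x \<notin> complex_vector.span B'"
    using perp [of x] x(2) span' by auto
  then have ind: "complex_vector.independent (insert x B')"
    using B'(2) by (simp add: complex_vector.independent_insertI)
  have "complex_vector.span (insert x B') = range R"
  proof
    show "complex_vector.span (insert x B') \<subseteq> range R"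
      using x(1) B'(1) \<open>range R' \<subseteq> range R\<close>
      by (intro complex_vector.span_minimal sub) auto
    show "range R \<subseteq> complex_vector.span (insert x B')"
    proof clarify
      fix z
      have "R z - (cinner (R z) x / complex_of_real ((norm x)\<^sup>2)) *\<^sub>C x \<in> complex_vector.span B'"
        unfolding span' by (auto simp: R'_def line_proj_def)
      then show "R z \<in> complex_vector.span (insert x B')"
        by (auto simp: complex_vector.span_insert)
    qed
  qed
  then have "card (insert x B') = card B"
    using complex_vector.dim_eq_card_independent [OF ind]
      complex_vector.dim_eq_card_independent [OF B(2)] B(3)
    by (metis complex_vector.dim_span)
  moreover have "x \<notin> B'"
    using \<open>x \<notin> complex_vector.span B'\<close> complex_vector.span_base by blast
  ultimately have "card B' = n"
    using \<open>finite B'\<close> card by simp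
  then show ?thesis
    using \<open>finite B'\<close> B'(2) span' R'_def by blast
qed

text \<open>
  The images \<open>R ` M e\<close> that are not zero form a chain of finite-dimensional subspaces.  If there
  are any, one of them is the smallest, and any nonzero vector in it serves; otherwise any nonzero
  vector in the range does.
\<close>

lemma vector_in_all_nonzero_images:
  fixes R :: "'a::complex_inner \<Rightarrow> 'a" and M N :: "'e \<Rightarrow> 'a set"
  assumes R: "bounded_clinear R" "finite B" "range R \<subseteq> complex_vector.span B" "range R \<noteq> {0}"
    and M: "\<And>e. e \<in> I \<Longrightarrow> complex_vector.subspace (M e)"
    and chain: "\<And>e f. e \<in> I \<Longrightarrow> f \<in> I \<Longrightarrow> M e \<subseteq> M f \<or> M f \<subseteq> M e"
    and RM: "\<And>e. e \<in> I \<Longrightarrow> R ` M e \<subseteq> N e"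
  shows "\<exists>x\<in>range R. x \<noteq> 0 \<and> (\<forall>e\<in>I. R ` M e \<subseteq> {0} \<or> x \<in> N e)"
proof (cases "\<forall>e\<in>I. R ` M e \<subseteq> {0}")
  case True
  have "0 \<in> range R"
    by (intro complex_vector.subspace_0 bounded_clinear_subspace_image R(1)
        complex_vector.subspace_UNIV)
  then show ?thesis
    using R(4) True by blast
next
  case False
  define \<C> where "\<C> = {R ` M e |e. e \<in> I \<and> \<not> R ` M e \<subseteq> {0}}"
  have "\<exists>U\<in>\<C>. \<forall>W\<in>\<C>. U \<subseteq> W"
  proof (rule smallest_subspace_in_chain)
    show "\<C> \<noteq> {}" using False by (auto simp: \<C>_def)
    show "complex_vector.subspace U" if "U \<in> \<C>" for U
      using that bounded_clinear_subspace_image [OF R(1)] M by (auto simp: \<C>_def)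
    show "U \<subseteq> W \<or> W \<subseteq> U" if "U \<in> \<C>" "W \<in> \<C>" for U W
    proof -
      obtain e f where "e \<in> I" "f \<in> I" "U = R ` M e" "W = R ` M f"
        using \<open>U \<in> \<C>\<close> \<open>W \<in> \<C>\<close> by (auto simp: \<C>_def)
      then show ?thesis
        using chain [of e f] by (auto intro: image_mono)
    qed
    show "finite B" by fact
    show "U \<subseteq> complex_vector.span B" if "U \<in> \<C>" for U
      using that R(3) by (auto simp: \<C>_def)
  qed
  then obtain U where U: "U \<in> \<C>" "\<And>W. W \<in> \<C> \<Longrightarrow> U \<subseteq> W"
    by blast
  then obtain x where x: "x \<in> U" "x \<noteq> 0"
    by (auto simp: \<C>_def)
  have "x \<in> range R"
    using U(1) x(1) by (auto simp: \<C>_def)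
  moreover have "x \<in> N e" if "e \<in> I" "\<not> R ` M e \<subseteq> {0}" for e
  proof -
    have "R ` M e \<in> \<C>"
      using that by (auto simp: \<C>_def)
    then show ?thesis
      using U(2) RM [OF that(1)] x(1) by blast
  qed
  ultimately show ?thesis
    using x(2) by blast
qed

text \<open>
  With \<open>x\<close> as above, \<open>line_proj x \<circ> R\<close> maps \<open>M e\<close> to zero if \<open>R\<close> does, and otherwise into the line
  of \<open>x\<close>, hence into \<open>N e\<close>.  It can thus be split off, and \<open>R - line_proj x \<circ> R\<close> has smaller rank.
\<close>

lemma rank_one_decomposition:
  fixes R :: "'a::complex_inner \<Rightarrow> 'a" and M N :: "'e \<Rightarrow> 'a set"
  assumes M: "\<And>e. e \<in> I \<Longrightarrow> complex_vector.subspace (M e)"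
    and N: "\<And>e. e \<in> I \<Longrightarrow> complex_vector.subspace (N e)"
    and chain: "\<And>e f. e \<in> I \<Longrightarrow> f \<in> I \<Longrightarrow> M e \<subseteq> M f \<or> M f \<subseteq> M e"
    and "bounded_clinear R" "\<And>e. e \<in> I \<Longrightarrow> R ` M e \<subseteq> N e"
    and "finite B" "complex_vector.independent B" "complex_vector.span B = range R" "card B = n"
  shows "\<exists>S :: nat \<Rightarrow> 'a \<Rightarrow> 'a.
    (\<forall>i<n. bounded_clinear (S i) \<and> (\<forall>e\<in>I. S i ` M e \<subseteq> N e) \<and> crank (S i) = 1) \<and>
    (\<forall>x. R x = (\<Sum>i<n. S i x))"
  using assms(4-)
proof (induction n arbitrary: R B)
  case 0
  then have "range R = {0}"
    by auto
  then show ?case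
    by auto
next
  case (Suc n)
  have "range R \<noteq> {0}"
  proof
    assume "range R = {0}"
    with Suc.prems(5) have "B \<subseteq> {0}"
      using complex_vector.span_superset by blast
    moreover have "B \<noteq> {}"
      using Suc.prems(6) by auto
    ultimately show False
      using Suc.prems(4) complex_vector.dependent_zero by blast
  qed
  then obtain x where x: "x \<in> range R" "x \<noteq> 0" "\<And>e. e \<in> I \<Longrightarrow> R ` M e \<subseteq> {0} \<or> x \<in> N e"
    using vector_in_all_nonzero_images [of R B I M N] Suc.prems M chain
    by (metis order_refl)
  define T where "T = (\<lambda>z. line_proj x (R z))"
  define R' where "R' = (\<lambda>z. R z - T z)"
  have T: "bounded_clinear T"
    unfolding T_def
    by (rule bounded_clinear_comp [OF bounded_clinear_line_proj Suc.prems(1)])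
  have R': "bounded_clinear R'"
    unfolding R'_def by (rule bounded_clinear_diff [OF Suc.prems(1) T])
  have TM: "T ` M e \<subseteq> N e" if e: "e \<in> I" for e
  proof -
    have "c *\<^sub>C x \<in> N e" if "x \<in> N e" for c
      using complex_vector.subspace_scale [OF N [OF e] that] .
    moreover have "T z = 0" if "R z = 0" for z
      using that by (simp add: T_def line_proj_def)
    ultimately show ?thesis
      using x(3) [OF e] complex_vector.subspace_0 [OF N [OF e]]
      by (auto simp: T_def line_proj_def image_subset_iff)
  qed
  have R'M: "R' ` M e \<subseteq> N e" if "e \<in> I" for e
    using TM [OF that] Suc.prems(2) [OF that] complex_vector.subspace_diff [OF N [OF that]]
    by (auto simp: R'_def)
  have rank_T: "crank T = 1"
  proof -
    have "crank T = card {x}"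
      unfolding crank_def using line_proj_range [OF Suc.prems(1) x(1)] x(2)
      by (intro complex_vector.dim_eq_card) (simp_all add: T_def complex_vector.span_span)
    then show ?thesis by simp
  qed
  obtain B' where B': "finite B'" "complex_vector.independent B'" "card B' = n"
    "complex_vector.span B' = range R'"
    using rank_diff_line_proj [OF Suc.prems(1) x(1,2) Suc.prems(3-6)] by (auto simp: R'_def T_def)
  obtain S where S: "\<forall>i<n. bounded_clinear (S i) \<and> (\<forall>e\<in>I. S i ` M e \<subseteq> N e) \<and> crank (S i) = 1"
    "\<forall>x. R' x = (\<Sum>i<n. S i x)"
    using Suc.IH [OF R' R'M B'(1,2,4,3)] by blast
  show ?case
  proof (intro exI [of _ "S(n := T)"] conjI)
    show "\<forall>i<Suc n. bounded_clinear ((S(n := T)) i) \<and>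
        (\<forall>e\<in>I. (S(n := T)) i ` M e \<subseteq> N e) \<and> crank ((S(n := T)) i) = 1"
      using S(1) T TM rank_T by (simp add: less_Suc_eq)
    show "\<forall>x. R x = (\<Sum>i<Suc n. (S(n := T)) i x)"
      using S(2) by (simp add: R'_def diff_eq_eq)
  qed
qed

section \<open>Finite rank operators in a 2-nest algebra\<close>

theorem theorem3p3:
  fixes \<E> :: "('a::chilbert_space \<Rightarrow> 'a) set"
    and R :: "'a \<Rightarrow> 'a"
    and n :: nat
  assumes "\<forall>E\<in>\<E>. partial_isometry E"
    and "\<forall>E\<in>\<E>. \<forall>F\<in>\<E>. E \<preceq> F \<or> F \<preceq> E"
    and "complete_family \<E>"
    and "subalgebra (op_space \<E>)"
    and "R \<in> op_space \<E>"
    and "n > 0"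
    and "crank R = n"
  shows "\<exists>S :: nat \<Rightarrow> 'a \<Rightarrow> 'a.
    (\<forall>i<n. S i \<in> op_space \<E> \<and> crank (S i) = 1) \<and> (\<forall>x. R x = (\<Sum>i<n. S i x))"
proof -
  note op = op_space_iff [OF assms(1)]
  have R: "bounded_clinear R" "\<And>E. E \<in> \<E> \<Longrightarrow> R ` initial_space E \<subseteq> {w. final_proj E w = w}"
    using assms(5) op by blast+
  have sub: "complex_vector.subspace (range R)"
    by (rule bounded_clinear_subspace_image [OF R(1) complex_vector.subspace_UNIV])
  obtain B where B: "B \<subseteq> range R" "complex_vector.independent B"
    "range R \<subseteq> complex_vector.span B" "card B = n"
    using complex_vector.basis_exists [of "range R"] assms(7) by (metis crank_def)
  have span: "complex_vector.span B = range R"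
    using B sub by (simp add: complex_vector.span_minimal subset_antisym)
  \<comment> \<open>Here \<open>n > 0\<close> excludes an infinite basis, whose cardinality would count as \<open>0\<close>.\<close>
  have "finite B"
    using B(4) assms(6) by (simp add: card_ge_0_finite)
  have "\<exists>S :: nat \<Rightarrow> 'a \<Rightarrow> 'a.
    (\<forall>i<n. bounded_clinear (S i) \<and>
      (\<forall>E\<in>\<E>. S i ` initial_space E \<subseteq> {w. final_proj E w = w}) \<and> crank (S i) = 1) \<and>
    (\<forall>x. R x = (\<Sum>i<n. S i x))"
  proof (rule rank_one_decomposition [OF subspace_initial_space _ _ R \<open>finite B\<close> B(2) span B(4)])
    show "complex_vector.subspace {w. final_proj E w = w}" if "E \<in> \<E>" for E
      using assms(1) that by (simp add: partial_isometry_def subspace_fixed_final_proj)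
    show "initial_space E \<subseteq> initial_space F \<or> initial_space F \<subseteq> initial_space E"
      if "E \<in> \<E>" "F \<in> \<E>" for E F
      using assms(1,2) that hm_le_initial_space_mono by blast
  qed
  then show ?thesis
    using op by blast
qed

end
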